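(* (i) Every normalized monotone set function $f$ on a finite ground set with supermodular degree $\mathrm{SD}(f)=d$ satisfies $\mathrm{SMW}(f)\le d$. (ii) For every integer $m\ge 2$ there exists a normalized monotone set function $f:2^{[m]}\to\mathbb{R}_{\ge 0}$ with $\mathrm{SMW}(f)=1$ and $\mathrm{SD}(f)=m-1$.
   Context: A set function $f:2^X\to\mathbb{R}$ is normalized if $f(\emptyset)=0$ and monotone if $f(S)\le f(T)$ whenever $S\subseteq T$. Write $f(S\mid T)=f(S\cup T)-f(T)$ and $f(v\mid T)=f(\{v\}\mid T)$. A set $T\subseteq X$ is supermodular w.r.t. $f$ if there exist $S\subseteq X$ and $v\in X\setminus T$ with $f(v\mid S\cup T)>\max_{T'\subsetneq T} f(v\mid S\cup T')$; the supermodular width $\mathrm{SMW}(f)$ is the maximum cardinality of a nonempty supermodular set (0 if none). For $u\neq v$ in $X$, $u$ positively depends on $v$ if there is $S\subseteq X$ with $f(u\mid S)>f(u\mid S\setminus\{v\})$; the supermodular degree is $\mathrm{SD}(f)=\max_{u\in X}|\{v: u \text{ positively depends on } v\}|$. $[m]=\{1,\dots,m\}$. *)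

theory Defs
  imports Complex_Main
begin

text \<open>A set function on a ground set \<open>X\<close> is a total function \<open>f :: 'a set \<Rightarrow> real\<close>, of which
  only the values on subsets of \<open>X\<close> matter; every notion below is relative to \<open>X\<close>.\<close>

definition normalized :: "('a set \<Rightarrow> real) \<Rightarrow> bool" where
  "normalized f \<longleftrightarrow> f {} = 0"

definition monotone_setfun :: "'a set \<Rightarrow> ('a set \<Rightarrow> real) \<Rightarrow> bool" where
  "monotone_setfun X f \<longleftrightarrow> (\<forall>S T. S \<subseteq> T \<and> T \<subseteq> X \<longrightarrow> f S \<le> f T)"

definition marginal :: "('a set \<Rightarrow> real) \<Rightarrow> 'a set \<Rightarrow> 'a set \<Rightarrow> real" where
  "marginal f S T = f (S \<union> T) - f T"

text \<open>For \<open>T = {}\<close> the maximum below ranges over the empty set and is unspecified; the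
  supermodular width considers nonempty \<open>T\<close> only.\<close>

definition supermodular_set :: "'a set \<Rightarrow> ('a set \<Rightarrow> real) \<Rightarrow> 'a set \<Rightarrow> bool" where
  "supermodular_set X f T \<longleftrightarrow> T \<subseteq> X \<and>
     (\<exists>S v. S \<subseteq> X \<and> v \<in> X - T \<and>
        marginal f {v} (S \<union> T) > Max ((\<lambda>T'. marginal f {v} (S \<union> T')) ` {T'. T' \<subset> T}))"

definition SMW :: "'a set \<Rightarrow> ('a set \<Rightarrow> real) \<Rightarrow> nat" where
  "SMW X f = Max (insert 0 (card ` {T. T \<noteq> {} \<and> supermodular_set X f T}))"

definition positively_depends :: "'a set \<Rightarrow> ('a set \<Rightarrow> real) \<Rightarrow> 'a \<Rightarrow> 'a \<Rightarrow> bool" where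
  "positively_depends X f u v \<longleftrightarrow> u \<in> X \<and> v \<in> X \<and> u \<noteq> v \<and>
     (\<exists>S. S \<subseteq> X \<and> marginal f {u} S > marginal f {u} (S - {v}))"

text \<open>Inserting \<open>0\<close> only matters for \<open>X = {}\<close>, where it makes the degree \<open>0\<close>.\<close>

definition SD :: "'a set \<Rightarrow> ('a set \<Rightarrow> real) \<Rightarrow> nat" where
  "SD X f = Max (insert 0 ((\<lambda>u. card {v. positively_depends X f u v}) ` X))"

end

theory Submission
  imports Defs
begin

text \<open>(i) If \<open>T\<close> is supermodular, witnessed by \<open>S\<close> and \<open>v\<close>, then removing any \<open>t \<in> T\<close> strictly
  decreases the marginal of \<open>v\<close>; hence \<open>t \<notin> S\<close>, and \<open>S \<union> T\<close> witnesses that \<open>v\<close> positively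
  depends on \<open>t\<close>. So \<open>v\<close> depends on all of \<open>T\<close>.

  (ii) Let \<open>f S = 1\<close> if \<open>S\<close> contains a fixed element \<open>a\<close> and at least one other element, and
  \<open>f S = 0\<close> otherwise. Any other single element already raises the marginal of \<open>a\<close> from \<open>0\<close> to its
  maximum \<open>1\<close>, so \<open>a\<close> depends on everything but no set of two elements is needed.\<close>

text \<open>For nonempty \<open>T\<close> the proper subsets form a finite nonempty family, so
  \<open>Max\<close> is a genuine maximum and exceeding it means exceeding every member.\<close>

lemma supermodular_set_iff:
  assumes "finite X" "T \<noteq> {}"
  shows "supermodular_set X f T \<longleftrightarrow> T \<subseteq> X \<and>
     (\<exists>S v. S \<subseteq> X \<and> v \<in> X - T \<and>
        (\<forall>T'. T' \<subset> T \<longrightarrow> marginal f {v} (S \<union> T') < marginal f {v} (S \<union> T)))"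
proof (cases "T \<subseteq> X")
  case True
  then have "finite {T'. T' \<subset> T}"
    using assms(1) by (auto intro: finite_subset[of _ "Pow T"] dest: finite_subset)
  moreover have "{T'. T' \<subset> T} \<noteq> {}"
    using assms(2) by auto
  ultimately show ?thesis
    by (simp add: supermodular_set_def)
qed (simp add: supermodular_set_def)

lemma finite_supermodular_sets:
  assumes "finite X"
  shows "finite {T. T \<noteq> {} \<and> supermodular_set X f T}"
  using assms by (auto simp: supermodular_set_def intro: finite_subset[of _ "Pow X"])

text \<open>The inserted \<open>0\<close> keeps \<open>Max\<close> defined when there is no
  supermodular set, and it never violates an upper bound in \<open>nat\<close>.\<close>

lemma SMW_le_iff:
  assumes "finite X"
  shows "SMW X f \<le> d \<longleftrightarrow> (\<forall>T. T \<noteq> {} \<and> supermodular_set X f T \<longrightarrow> card T \<le> d)"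
  unfolding SMW_def using finite_supermodular_sets[OF assms, of f] by auto

lemma card_le_SMW:
  assumes "finite X" "T \<noteq> {}" "supermodular_set X f T"
  shows "card T \<le> SMW X f"
  using SMW_le_iff[OF assms(1), of f "SMW X f"] assms by auto

lemma SD_le_iff:
  assumes "finite X"
  shows "SD X f \<le> d \<longleftrightarrow> (\<forall>u\<in>X. card {v. positively_depends X f u v} \<le> d)"
  unfolding SD_def using assms by auto

lemma card_positively_depends_le_SD:
  assumes "finite X" "u \<in> X"
  shows "card {v. positively_depends X f u v} \<le> SD X f"
  using SD_le_iff[OF assms(1), of f "SD X f"] assms by auto

lemma positively_depends_subset: "{v. positively_depends X f u v} \<subseteq> X - {u}"
  by (auto simp: positively_depends_def)

lemma SMW_le_SD:
  assumes X: "finite X"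
  shows "SMW X f \<le> SD X f"
  unfolding SMW_le_iff[OF X]
proof (intro allI impI, elim conjE)
  fix T assume T: "T \<noteq> {}" "supermodular_set X f T"
  then obtain S v where "T \<subseteq> X" "S \<subseteq> X" and v: "v \<in> X" "v \<notin> T"
    and less: "\<And>T'. T' \<subset> T \<Longrightarrow> marginal f {v} (S \<union> T') < marginal f {v} (S \<union> T)"
    by (auto simp: supermodular_set_iff[OF X])
  have "positively_depends X f v t" if t: "t \<in> T" for t
  proof -
    have lt: "marginal f {v} (S \<union> (T - {t})) < marginal f {v} (S \<union> T)"
      using t by (intro less) auto
    have "t \<notin> S"
    proof
      assume "t \<in> S"
      then have "S \<union> (T - {t}) = S \<union> T" by auto
      with lt show False by simp
    qed
    then have "S \<union> (T - {t}) = S \<union> T - {t}" by auto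
    with lt show ?thesis
      using t v \<open>T \<subseteq> X\<close> \<open>S \<subseteq> X\<close> unfolding positively_depends_def
      by (metis Un_least subsetD)
  qed
  then have "card T \<le> card {t. positively_depends X f v t}"
    using finite_subset[OF positively_depends_subset] X by (intro card_mono) auto
  also have "\<dots> \<le> SD X f"
    using X v by (intro card_positively_depends_le_SD)
  finally show "card T \<le> SD X f" .
qed

definition companion_fun :: "'a \<Rightarrow> 'a set \<Rightarrow> real" where
  "companion_fun a S = (if a \<in> S \<and> S \<noteq> {a} then 1 else 0)"

lemma companion_fun_mono: "S \<subseteq> T \<Longrightarrow> companion_fun a S \<le> companion_fun a T"
  by (auto simp: companion_fun_def)

text \<open>The case \<open>U = {}\<close> gives \<open>0\<close> because \<open>a\<close> alone has
  value \<open>0\<close>; this jump from \<open>{}\<close> to any other set avoiding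
  \<open>a\<close> is the only source of supermodularity at \<open>a\<close>.\<close>

lemma marginal_companion_fun_self:
  "marginal (companion_fun a) {a} U = (if a \<in> U \<or> U = {} then 0 else 1)"
  by (auto simp: marginal_def companion_fun_def insert_absorb)

text \<open>Once \<open>w\<close> is present, the value depends only on whether \<open>a\<close> is
  present, which adding \<open>v\<close> does not change.\<close>

lemma marginal_companion_fun_other:
  assumes "v \<noteq> a" "w \<in> U" "w \<noteq> a"
  shows "marginal (companion_fun a) {v} U = 0"
  using assms by (auto simp: marginal_def companion_fun_def)

lemma marginal_companion_fun_nonneg: "0 \<le> marginal (companion_fun a) {v} U"
  unfolding marginal_def using companion_fun_mono[of U "{v} \<union> U" a] by auto

lemma SMW_companion_fun:
  assumes X: "finite X" and "a \<in> X" "b \<in> X" "a \<noteq> b"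
  shows "SMW X (companion_fun a) = 1"
proof (rule antisym)
  show "SMW X (companion_fun a) \<le> 1"
    unfolding SMW_le_iff[OF X]
  proof (intro allI impI, elim conjE)
    fix T assume T: "T \<noteq> {}" "supermodular_set X (companion_fun a) T"
    then obtain S v where v: "v \<notin> T"
      and less: "\<And>T'. T' \<subset> T \<Longrightarrow>
        marginal (companion_fun a) {v} (S \<union> T') < marginal (companion_fun a) {v} (S \<union> T)"
      by (auto simp: supermodular_set_iff[OF X])
    show "card T \<le> 1"
    proof (rule ccontr)
      assume "\<not> card T \<le> 1"
      \<comment> \<open>At most one of two distinct elements of \<open>T\<close> is
        \<open>a\<close>; call \<open>w\<close> one that is not, and remove the other, so that
        \<open>w\<close> stays in \<open>T - {t}\<close>.\<close>
      then obtain t w where tw: "t \<in> T" "w \<in> T" "t \<noteq> w" "w \<noteq> a"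
        by (metis card_le_Suc0_iff_eq card.infinite One_nat_def zero_le)
      have lt: "marginal (companion_fun a) {v} (S \<union> (T - {t}))
          < marginal (companion_fun a) {v} (S \<union> T)"
        using tw by (intro less) auto
      show False
      proof (cases "v = a")
        case True
        \<comment> \<open>Here \<open>a\<close> is not in \<open>T\<close>, so both sets contain
          \<open>w\<close>, and each contains \<open>a\<close> exactly when \<open>S\<close> does:
          the two marginals agree.\<close>
        then show False
          using lt tw v by (auto simp: marginal_companion_fun_self split: if_splits)
      next
        case False
        \<comment> \<open>The larger marginal vanishes because of \<open>w\<close>, while
          monotonicity keeps the smaller one nonnegative.\<close>
        then have "marginal (companion_fun a) {v} (S \<union> T) = 0"
          using tw by (intro marginal_companion_fun_other[where w = w]) auto
        with lt marginal_companion_fun_nonneg[of a v "S \<union> (T - {t})"] show False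
          by simp
      qed
    qed
  qed
  \<comment> \<open>With \<open>S = {}\<close> and \<open>v = a\<close>, the only proper subset of
    \<open>{b}\<close> is \<open>{}\<close>, and the marginal of \<open>a\<close> rises from
    \<open>0\<close> to \<open>1\<close>.\<close>
  have "supermodular_set X (companion_fun a) {b}"
    using assms unfolding supermodular_set_iff[OF X insert_not_empty]
    by (intro conjI exI[of _ "{}"] exI[of _ a])
      (auto simp: marginal_companion_fun_self subset_singleton_iff)
  from card_le_SMW[OF X _ this] show "1 \<le> SMW X (companion_fun a)" by simp
qed

lemma SD_companion_fun:
  assumes X: "finite X" and a: "a \<in> X"
  shows "SD X (companion_fun a) = card X - 1"
proof (rule antisym)
  show "SD X (companion_fun a) \<le> card X - 1"
    unfolding SD_le_iff[OF X]
  proof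
    fix u assume "u \<in> X"
    with X show "card {v. positively_depends X (companion_fun a) u v} \<le> card X - 1"
      using card_mono[OF _ positively_depends_subset[of X _ u]] by simp
  qed
  have "positively_depends X (companion_fun a) a v" if "v \<in> X" "v \<noteq> a" for v
    unfolding positively_depends_def
    \<comment> \<open>Removing \<open>v\<close> from the witness \<open>{v}\<close> leaves
      \<open>{}\<close>, where the marginal of \<open>a\<close> drops to \<open>0\<close>.\<close>
    using that a by (auto simp: marginal_companion_fun_self intro!: exI[of _ "{v}"])
  then have "{v. positively_depends X (companion_fun a) a v} = X - {a}"
    using positively_depends_subset[of X "companion_fun a" a] by auto
  then show "card X - 1 \<le> SD X (companion_fun a)"
    using card_positively_depends_le_SD[OF X a, of "companion_fun a"] a X by simp
qed

theorem theorem3: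
  shows "(\<forall>(X :: 'a set) (f :: 'a set \<Rightarrow> real) (d :: nat).
            finite X \<and> normalized f \<and> monotone_setfun X f \<and> SD X f = d \<longrightarrow> SMW X f \<le> d)
       \<and> (\<forall>m :: nat. m \<ge> 2 \<longrightarrow>
            (\<exists>f :: nat set \<Rightarrow> real.
               (\<forall>S. S \<subseteq> {1..m} \<longrightarrow> f S \<ge> 0) \<and> normalized f \<and> monotone_setfun {1..m} f
               \<and> SMW {1..m} f = 1 \<and> SD {1..m} f = m - 1))"
proof (rule conjI)
  show "\<forall>(X :: 'a set) (f :: 'a set \<Rightarrow> real) (d :: nat).
      finite X \<and> normalized f \<and> monotone_setfun X f \<and> SD X f = d \<longrightarrow> SMW X f \<le> d"
    using SMW_le_SD by blast
  show "\<forall>m :: nat. m \<ge> 2 \<longrightarrow>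
      (\<exists>f :: nat set \<Rightarrow> real.
         (\<forall>S. S \<subseteq> {1..m} \<longrightarrow> f S \<ge> 0) \<and> normalized f \<and> monotone_setfun {1..m} f
         \<and> SMW {1..m} f = 1 \<and> SD {1..m} f = m - 1)"
  proof (intro allI impI exI conjI)
    fix m :: nat assume m: "m \<ge> 2"
    let ?f = "companion_fun (1 :: nat)"
    show "0 \<le> ?f S" for S by (simp add: companion_fun_def)
    show "normalized ?f" by (simp add: normalized_def companion_fun_def)
    show "monotone_setfun {1..m} ?f" by (simp add: monotone_setfun_def companion_fun_mono)
    \<comment> \<open>The bound \<open>m \<ge> 2\<close> supplies \<open>2\<close> as a companion of
      \<open>1\<close>.\<close>
    show "SMW {1..m} ?f = 1" using m by (intro SMW_companion_fun[where b = 2]) auto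
    show "SD {1..m} ?f = m - 1" using m by (subst SD_companion_fun) auto
  qed
qed

end
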